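(* The bound-preserving limiter $\Pi_h$ defined in the context satisfies the Abgrall condition around an isolated material interface: for any constant vector $\mathbf u_0\in\mathbb R^2$ and constant $p_0\in\mathbb R$, if the piecewise polynomial solution $\mathbf U_\sigma^n$ satisfies $$\mathbf u_\sigma^n(x,y)\equiv\mathbf u_0,\qquad p_\sigma^n(x,y)\equiv p_0,$$ where $\mathbf u_\sigma^n=\mathbf u(\mathbf U_\sigma^n)$, $p_\sigma^n=p(\mathbf U_\sigma^n)$, then on each element $I_{i,j}$ $$\mathbf u_{i,j}^n(x,y)\equiv\mathbf u_0,\qquad p_{i,j}^n(x,y)\equiv p_0,$$ where $\mathbf u_{i,j}^n:=\mathbf u(\Pi_h\mathbf U_\sigma^n(x,y))$ and $p_{i,j}^n:=p(\Pi_h\mathbf U_\sigma^n(x,y))$.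
   Context: **State.** $\mathbf U=(z_1\rho_1,z_2\rho_2,\rho u,\rho v,E,z_1)$ (6 components), $z_2=1-z_1$, $\rho=z_1\rho_1+z_2\rho_2$. Constants $\gamma_1,\gamma_2>1$, $p_{w,1},p_{w,2}\in\mathbb R$. Velocity $\mathbf u(\mathbf U)=(\rho u,\rho v)/\rho$; pressure $p(\mathbf U)=(E-\frac12\rho|\mathbf u|^2)(\gamma-1)-\gamma p_w$, where $\frac1{\gamma-1}=\frac{z_1}{\gamma_1-1}+\frac{z_2}{\gamma_2-1}$ and $\frac{\gamma p_w}{\gamma-1}=\frac{z_1\gamma_1p_{w,1}}{\gamma_1-1}+\frac{z_2\gamma_2p_{w,2}}{\gamma_2-1}$; squared sound speed $\tilde c^2(\mathbf U)=\gamma(p+p_w)/\rho$. It is understood that these are well defined for the states at which they are evaluated ($\rho\ne0$ and $\frac{z_1}{\gamma_1-1}+\frac{z_2}{\gamma_2-1}\neq0$). **Mesh.** $\Omega\subset\mathbb R^2$ is a rectangle divided into uniform Cartesian cells $I_{i,j}$. $\mathbf U_\sigma^n$ is a vector function whose components restricted to each $I_{i,j}$ are polynomials of total degree $\le K$; $\overline{\mathbf U}_{i,j}^n$ is its average over $I_{i,j}$, and $\overline{(\cdot)}_{i,j}^n$ denotes the corresponding component of the average. $\mathbb S_{i,j}$ is a finite set of (tensor Gauss–Lobatto) quadrature points in $I_{i,j}$. **Limiter.** On $I_{i,j}$: Step 1. $\widetilde{\mathbf U}_\sigma^n=\overline{\mathbf U}_{i,j}^n+\theta_{z\rho}(\mathbf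 U_\sigma^n-\overline{\mathbf U}_{i,j}^n)$, $\theta_{z\rho}=\min\{\theta_{z_1\rho_1},\theta_{z_2\rho_2},\theta_{z_1}\}$, where, for $\ell=1,2$, $\varepsilon_\ell=\min\{(\overline{z_\ell\rho_\ell})_{i,j}^n,10^{-13}\}$, $\varepsilon_z=\min\{(\overline{z_1})_{i,j}^n,1-(\overline{z_1})_{i,j}^n,10^{-13}\}$, $$\theta_{z_\ell\rho_\ell}=\begin{cases}\dfrac{(\overline{z_\ell\rho_\ell})_{i,j}^n-\varepsilon_\ell}{(\overline{z_\ell\rho_\ell})_{i,j}^n-\min_{\mathbb S_{i,j}}(z_\ell\rho_\ell)_\sigma^n}&\text{if }\min_{\mathbb S_{i,j}}(z_\ell\rho_\ell)_\sigma^n<\varepsilon_\ell,\\1&\text{otherwise,}\end{cases}$$ $$\theta_{z_1}=\begin{cases}\dfrac{(\overline{z_1})_{i,j}^n-\varepsilon_z}{(\overline{z_1})_{i,j}^n-m_{i,j}}&\text{if }m_{i,j}<\varepsilon_z,\\[1ex]\dfrac{(1-\varepsilon_z)-(\overline{z_1})_{i,j}^n}{M_{i,j}-(\overline{z_1})_{i,j}^n}&\text{if }M_{i,j}>1-\varepsilon_z,\\1&\text{otherwise,}\end{cases}$$ with $M_{i,j}=\max_{\mathbb S_{i,j}}(z_1)_\sigma^n$, $m_{i,j}=\min_{\mathbb S_{i,j}}(z_1)_\sigma^n$. Step 2. $\mathbf U_{i,j}^n=\overline{\mathbf U}_{i,j}^n+\theta_c(\widetilde{\mathbf U}_\sigma^n-\overline{\mathbf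 U}_{i,j}^n)$, with $\varepsilon_c=\min\{\tilde c^2(\overline{\mathbf U}_{i,j}^n),10^{-13}\}$ and $$\theta_c=\begin{cases}\dfrac{\tilde c^2(\overline{\mathbf U}_{i,j}^n)-\varepsilon_c}{\tilde c^2(\overline{\mathbf U}_{i,j}^n)-\min_{\mathbb S_{i,j}}\tilde c^2(\widetilde{\mathbf U}_\sigma^n)}&\text{if }\min_{\mathbb S_{i,j}}\tilde c^2(\widetilde{\mathbf U}_\sigma^n)<\varepsilon_c,\\1&\text{otherwise.}\end{cases}$$ The limiter is $\Pi_h(\mathbf U_\sigma^n):=\mathbf U_{i,j}^n=\overline{\mathbf U}_{i,j}^n+\theta_c\theta_{z\rho}(\mathbf U_\sigma^n-\overline{\mathbf U}_{i,j}^n)$ on $I_{i,j}$. *)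

theory Defs
  imports "HOL-Analysis.Analysis"
begin

section \<open>State vector and equation of state\<close>

text \<open>A state lists the components z1 rho1, z2 rho2, rho u, rho v, E, z1 in this order.\<close>

type_synonym state = "real ^ 6"
type_synonym point = "real \<times> real"

record gas =
  gam1 :: real
  gam2 :: real
  pw1 :: real
  pw2 :: real

definition valid_gas :: "gas \<Rightarrow> bool" where
  "valid_gas g \<longleftrightarrow> gam1 g > 1 \<and> gam2 g > 1"

definition z1rho1 :: "state \<Rightarrow> real" where "z1rho1 U = U $ 1"
definition z2rho2 :: "state \<Rightarrow> real" where "z2rho2 U = U $ 2"
definition momentum :: "state \<Rightarrow> real \<times> real" where "momentum U = (U $ 3, U $ 4)"
definition energy :: "state \<Rightarrow> real" where "energy U = U $ 5"
definition z1 :: "state \<Rightarrow> real" where "z1 U = U $ 6"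
definition z2 :: "state \<Rightarrow> real" where "z2 U = 1 - z1 U"

definition density :: "state \<Rightarrow> real" where
  "density U = z1rho1 U + z2rho2 U"

definition velocity :: "state \<Rightarrow> real \<times> real" where
  "velocity U = (1 / density U) *\<^sub>R momentum U"

definition mix_xi :: "gas \<Rightarrow> state \<Rightarrow> real" where
  "mix_xi g U = z1 U / (gam1 g - 1) + z2 U / (gam2 g - 1)"

definition mix_eta :: "gas \<Rightarrow> state \<Rightarrow> real" where
  "mix_eta g U = z1 U * gam1 g * pw1 g / (gam1 g - 1) + z2 U * gam2 g * pw2 g / (gam2 g - 1)"

definition mix_gamma :: "gas \<Rightarrow> state \<Rightarrow> real" where
  "mix_gamma g U = 1 + 1 / mix_xi g U"

text \<open>The product of the mixture gamma and p_w. Only this product is used, as p_w alone would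
  be undetermined at states where the mixture gamma vanishes (possible for z1 outside [0,1]).\<close>

definition mix_gamma_pw :: "gas \<Rightarrow> state \<Rightarrow> real" where
  "mix_gamma_pw g U = (mix_gamma g U - 1) * mix_eta g U"

definition pressure :: "gas \<Rightarrow> state \<Rightarrow> real" where
  "pressure g U =
     (energy U - 1/2 * density U * (norm (velocity U))\<^sup>2) * (mix_gamma g U - 1) - mix_gamma_pw g U"

definition sound_speed_sq :: "gas \<Rightarrow> state \<Rightarrow> real" where
  "sound_speed_sq g U = (mix_gamma g U * pressure g U + mix_gamma_pw g U) / density U"

definition well_defined :: "gas \<Rightarrow> state \<Rightarrow> bool" where
  "well_defined g U \<longleftrightarrow> density U \<noteq> 0 \<and> mix_xi g U \<noteq> 0"

lemma mixture_relations:
  assumes "well_defined g U"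
  shows "1 / (mix_gamma g U - 1) = mix_xi g U"
    and "mix_gamma_pw g U / (mix_gamma g U - 1) = mix_eta g U"
  using assms by (auto simp: well_defined_def mix_gamma_def mix_gamma_pw_def)

lemma sound_speed_sq_eq:
  assumes "mix_gamma g U * pw = mix_gamma_pw g U"
  shows "sound_speed_sq g U = mix_gamma g U * (pressure g U + pw) / density U"
  using assms by (simp add: sound_speed_sq_def distrib_left)


section \<open>Mesh and piecewise polynomials\<close>

record mesh =
  xleft :: real
  xright :: real
  ybot :: real
  ytop :: real
  ncx :: nat
  ncy :: nat

definition valid_mesh :: "mesh \<Rightarrow> bool" where
  "valid_mesh m \<longleftrightarrow> xleft m < xright m \<and> ybot m < ytop m \<and> 0 < ncx m \<and> 0 < ncy m"

definition cell_indices :: "mesh \<Rightarrow> (nat \<times> nat) set" where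
  "cell_indices m = {..<ncx m} \<times> {..<ncy m}"

definition cell :: "mesh \<Rightarrow> nat \<times> nat \<Rightarrow> point set" where
  "cell m = (\<lambda>(i, j).
     let dx = (xright m - xleft m) / real (ncx m); dy = (ytop m - ybot m) / real (ncy m)
     in {xleft m + real i * dx .. xleft m + (real i + 1) * dx} \<times>
        {ybot m + real j * dy .. ybot m + (real j + 1) * dy})"

definition polynomial2_on :: "nat \<Rightarrow> point set \<Rightarrow> (point \<Rightarrow> real) \<Rightarrow> bool" where
  "polynomial2_on K C f \<longleftrightarrow>
     (\<exists>c :: nat \<Rightarrow> nat \<Rightarrow> real. \<forall>(x, y) \<in> C. f (x, y) = (\<Sum>a\<le>K. \<Sum>b\<le>K - a. c a b * x ^ a * y ^ b))"

text \<open>Piecewise polynomials are families indexed by the cells: adjacent closed cells share edges,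
  on which the one-sided traces (evaluated at edge quadrature points) may differ.\<close>

definition piecewise_polynomial :: "nat \<Rightarrow> mesh \<Rightarrow> (nat \<times> nat \<Rightarrow> point \<Rightarrow> state) \<Rightarrow> bool" where
  "piecewise_polynomial K m U \<longleftrightarrow>
     (\<forall>I \<in> cell_indices m. \<forall>k. polynomial2_on K (cell m I) (\<lambda>q. U I q $ k))"

definition cell_average :: "point set \<Rightarrow> (point \<Rightarrow> state) \<Rightarrow> state" where
  "cell_average C U = (1 / measure lebesgue C) *\<^sub>R integral C U"

definition min_over :: "point set \<Rightarrow> (point \<Rightarrow> real) \<Rightarrow> real" where
  "min_over S f = Min (f ` S)"

definition max_over :: "point set \<Rightarrow> (point \<Rightarrow> real) \<Rightarrow> real" where
  "max_over S f = Max (f ` S)"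


section \<open>The bound-preserving limiter on one cell\<close>

text \<open>Below, C is a cell, S its set of quadrature points and U the numerical solution on C.\<close>

text \<open>Here a is the value at the cell average and f gives the point values; the same formula
  serves the two partial densities and the squared sound speed.\<close>

definition theta_lower :: "point set \<Rightarrow> real \<Rightarrow> (point \<Rightarrow> real) \<Rightarrow> real" where
  "theta_lower S a f =
     (let eps = min a (1 / 10 ^ 13)
      in if min_over S f < eps then (a - eps) / (a - min_over S f) else 1)"

definition theta_z1 :: "point set \<Rightarrow> real \<Rightarrow> (point \<Rightarrow> real) \<Rightarrow> real" where
  "theta_z1 S a f =
     (let eps = min a (min (1 - a) (1 / 10 ^ 13))
      in if min_over S f < eps then (a - eps) / (a - min_over S f)
         else if max_over S f > 1 - eps then ((1 - eps) - a) / (max_over S f - a)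
         else 1)"

definition theta_zrho :: "point set \<Rightarrow> point set \<Rightarrow> (point \<Rightarrow> state) \<Rightarrow> real" where
  "theta_zrho C S U =
     (let A = cell_average C U
      in Min {theta_lower S (z1rho1 A) (\<lambda>q. z1rho1 (U q)),
              theta_lower S (z2rho2 A) (\<lambda>q. z2rho2 (U q)),
              theta_z1 S (z1 A) (\<lambda>q. z1 (U q))})"

definition limiter_step1 :: "point set \<Rightarrow> point set \<Rightarrow> (point \<Rightarrow> state) \<Rightarrow> point \<Rightarrow> state" where
  "limiter_step1 C S U q = cell_average C U + theta_zrho C S U *\<^sub>R (U q - cell_average C U)"

definition theta_c :: "gas \<Rightarrow> point set \<Rightarrow> point set \<Rightarrow> (point \<Rightarrow> state) \<Rightarrow> real" where
  "theta_c g C S U =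
     theta_lower S (sound_speed_sq g (cell_average C U)) (\<lambda>q. sound_speed_sq g (limiter_step1 C S U q))"

definition limiter :: "gas \<Rightarrow> point set \<Rightarrow> point set \<Rightarrow> (point \<Rightarrow> state) \<Rightarrow> point \<Rightarrow> state" where
  "limiter g C S U q =
     cell_average C U + theta_c g C S U *\<^sub>R (limiter_step1 C S U q - cell_average C U)"

lemma limiter_eq:
  "limiter g C S U q =
     cell_average C U + (theta_c g C S U * theta_zrho C S U) *\<^sub>R (U q - cell_average C U)"
  by (simp add: limiter_def limiter_step1_def)

end

theory Submission
  imports Defs
begin

text \<open>For well-defined states, having velocity u0 and pressure p0 is an affine condition on the
  conserved variables, because 1 / (gamma - 1) and gamma p_w / (gamma - 1) are affine in z1. The cell
  average inherits an affine condition that holds throughout the cell, and the limited state is an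
  affine combination of a point value and the average.\<close>

text \<open>The components are the residuals of the momentum and energy relations for velocity u and
  pressure p. The part of the energy relation independent of \<open>W\<close> is left out, which
  makes the map linear and turns the condition on \<open>W\<close> into a fixed nonzero target
  value.\<close>

definition interface_map :: "gas \<Rightarrow> real \<times> real \<Rightarrow> real \<Rightarrow> state \<Rightarrow> (real \<times> real) \<times> real" where
  "interface_map g u p W =
     (momentum W - density W *\<^sub>R u,
      energy W - density W * (norm u)\<^sup>2 / 2
        - z1 W * ((p + gam1 g * pw1 g) / (gam1 g - 1) - (p + gam2 g * pw2 g) / (gam2 g - 1)))"

lemma linear_interface_map: "linear (interface_map g u p)"
  by (rule linearI)
    (auto simp: interface_map_def momentum_def density_def energy_def z1rho1_def z2rho2_def z1_def
      prod_eq_iff algebra_simps add_divide_distrib diff_divide_distrib)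

lemma velocity_eq_iff:
  assumes "density W \<noteq> 0"
  shows "velocity W = u \<longleftrightarrow> momentum W - density W *\<^sub>R u = 0"
  using assms by (auto simp: velocity_def)

text \<open>\<open>mix_gamma g W - 1\<close> is the reciprocal of \<open>mix_xi g W\<close>;
  clearing this denominator leaves a right-hand side affine in \<open>z1 W\<close>.\<close>

lemma pressure_eq_iff:
  assumes "mix_xi g W \<noteq> 0"
  shows "pressure g W = p \<longleftrightarrow>
    energy W - density W * (norm (velocity W))\<^sup>2 / 2 = p * mix_xi g W + mix_eta g W"
proof -
  \<comment> \<open>If \<open>mix_xi g W = 0\<close>, both sides are 0 by the convention x / 0 = 0;
    the assumption enters when the quotient is cleared.\<close>
  have "pressure g W =
      (energy W - density W * (norm (velocity W))\<^sup>2 / 2 - mix_eta g W) / mix_xi g W"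
    by (simp add: pressure_def mix_gamma_def mix_gamma_pw_def diff_divide_distrib)
  then show ?thesis
    using assms by (auto simp: divide_eq_eq)
qed

text \<open>The kinetic energy is nonlinear in the state, but once the velocity equals u it is the
  density times a constant. The momentum component secures this first, so the energy component can
  then express the pressure.\<close>

lemma interface_map_eq_iff:
  assumes "well_defined g W"
  shows "velocity W = u \<and> pressure g W = p \<longleftrightarrow>
    interface_map g u p W = (0, (p + gam2 g * pw2 g) / (gam2 g - 1))"
proof -
  let ?d = "(p + gam1 g * pw1 g) / (gam1 g - 1) - (p + gam2 g * pw2 g) / (gam2 g - 1)"
  \<comment> \<open>Substituting z2 = 1 - z1 separates the slope in z1, subtracted in
    \<open>interface_map\<close>, from the constant term, which is the target value.\<close>
  have "p * mix_xi g W + mix_eta g W = z1 W * ?d + (p + gam2 g * pw2 g) / (gam2 g - 1)"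
    unfolding mix_xi_def mix_eta_def z2_def
    by (simp add: algebra_simps add_divide_distrib diff_divide_distrib)
  then show ?thesis
    using assms velocity_eq_iff[of W u] pressure_eq_iff[of g W p]
    by (auto simp: interface_map_def well_defined_def algebra_simps)
qed

text \<open>A linear map commutes with the integral of an integrable function, and the nonzero
  measure cancels against the normalisation of the average.\<close>

lemma cell_average_linear:
  fixes L :: "state \<Rightarrow> 'b::euclidean_space"
  assumes "linear L" and "U integrable_on cbox a b" and "measure lebesgue (cbox a b) \<noteq> 0"
    and const: "\<And>q. q \<in> cbox a b \<Longrightarrow> L (U q) = c"
  shows "L (cell_average (cbox a b) U) = c"
proof -
  have "L (integral (cbox a b) U) = integral (cbox a b) (L \<circ> U)"
    using assms by (simp add: integral_linear linear_conv_bounded_linear)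
  also have "\<dots> = integral (cbox a b) (\<lambda>_. c)"
    by (rule integral_cong) (simp add: const)
  also have "\<dots> = measure lebesgue (cbox a b) *\<^sub>R c"
    by simp
  finally show ?thesis
    using assms(1,3) by (simp add: cell_average_def linear_scale)
qed

lemma continuous_on_polynomial2:
  assumes "polynomial2_on K C f"
  shows "continuous_on C f"
proof -
  obtain c where c: "\<And>x y. (x, y) \<in> C \<Longrightarrow> f (x, y) = (\<Sum>a\<le>K. \<Sum>b\<le>K - a. c a b * x ^ a * y ^ b)"
    using assms unfolding polynomial2_on_def by blast
  have "continuous_on C (\<lambda>q. \<Sum>a\<le>K. \<Sum>b\<le>K - a. c a b * fst q ^ a * snd q ^ b)"
    by (intro continuous_intros)
  then show ?thesis
    by (rule continuous_on_eq) (auto simp: c)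
qed

text \<open>Continuity on the closed cell supplies the integrability needed for averaging.\<close>

lemma piecewise_polynomial_continuous_on:
  assumes "piecewise_polynomial K m U" and "I \<in> cell_indices m"
  shows "continuous_on (cell m I) (U I)"
proof -
  have "continuous_on (cell m I) (\<lambda>q. \<chi> k. U I q $ k)"
    using assms unfolding piecewise_polynomial_def
    by (intro continuous_on_vec_lambda continuous_on_polynomial2) blast
  then show ?thesis by simp
qed

lemma cell_eq_cbox:
  assumes "valid_mesh m"
  obtains a b where "cell m I = cbox a b" and "measure lebesgue (cbox a b) \<noteq> 0"
proof (cases I)
  case (Pair i j)
  define dx where "dx = (xright m - xleft m) / real (ncx m)"
  define dy where "dy = (ytop m - ybot m) / real (ncy m)"
  define a where "a = (xleft m + real i * dx, ybot m + real j * dy)"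
  define b where "b = (xleft m + (real i + 1) * dx, ybot m + (real j + 1) * dy)"
  have "dx > 0" "dy > 0"
    using assms by (auto simp: valid_mesh_def dx_def dy_def)
  then have "measure lebesgue (cbox a b) \<noteq> 0"
    by (simp add: a_def b_def content_Pair distrib_right)
  moreover have "cell m I = cbox a b"
    by (simp add: Pair cell_def Let_def a_def b_def cbox_Pair_eq dx_def dy_def)
  ultimately show ?thesis using that by blast
qed

theorem theorem4p2:
  fixes g :: gas and m :: mesh and K :: nat
    and S :: "nat \<times> nat \<Rightarrow> point set"
    and U :: "nat \<times> nat \<Rightarrow> point \<Rightarrow> state"
    and u0 :: "real \<times> real" and p0 :: real
  assumes gas: "valid_gas g"
    and mesh: "valid_mesh m"
    and quad: "\<And>I. I \<in> cell_indices m \<Longrightarrow> finite (S I) \<and> S I \<noteq> {} \<and> S I \<subseteq> cell m I"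
    and poly: "piecewise_polynomial K m U"
    and wd_solution: "\<And>I q. I \<in> cell_indices m \<Longrightarrow> q \<in> cell m I \<Longrightarrow> well_defined g (U I q)"
    and wd_average: "\<And>I. I \<in> cell_indices m \<Longrightarrow> well_defined g (cell_average (cell m I) (U I))"
    and wd_step1: "\<And>I q. I \<in> cell_indices m \<Longrightarrow> q \<in> S I \<Longrightarrow>
                     well_defined g (limiter_step1 (cell m I) (S I) (U I) q)"
    and wd_limited: "\<And>I q. I \<in> cell_indices m \<Longrightarrow> q \<in> cell m I \<Longrightarrow>
                     well_defined g (limiter g (cell m I) (S I) (U I) q)"
    and velocity_const: "\<And>I q. I \<in> cell_indices m \<Longrightarrow> q \<in> cell m I \<Longrightarrow> velocity (U I q) = u0"
    and pressure_const: "\<And>I q. I \<in> cell_indices m \<Longrightarrow> q \<in> cell m I \<Longrightarrow> pressure g (U I q) = p0"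
  shows "\<forall>I \<in> cell_indices m. \<forall>q \<in> cell m I.
           velocity (limiter g (cell m I) (S I) (U I) q) = u0 \<and>
           pressure g (limiter g (cell m I) (S I) (U I) q) = p0"
proof (intro ballI)
  fix I q
  assume I: "I \<in> cell_indices m" and q: "q \<in> cell m I"
  let ?L = "interface_map g u0 p0"
  let ?c = "(0, (p0 + gam2 g * pw2 g) / (gam2 g - 1))"
  have point: "?L (U I q) = ?c" if "q \<in> cell m I" for q
    using interface_map_eq_iff[OF wd_solution[OF I that]] velocity_const[OF I that]
      pressure_const[OF I that] by blast
  obtain a b where cell: "cell m I = cbox a b" and pos: "measure lebesgue (cbox a b) \<noteq> 0"
    using cell_eq_cbox[OF mesh] .
  have "U I integrable_on cbox a b"
    using piecewise_polynomial_continuous_on[OF poly I] cell by (simp add: integrable_continuous)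
  then have average: "?L (cell_average (cell m I) (U I)) = ?c"
    using cell_average_linear[OF linear_interface_map _ pos] point cell by simp
  \<comment> \<open>With t the product of the two limiter factors, linearity gives c + t (c - c) =
    c, whatever the value of t.\<close>
  have "?L (limiter g (cell m I) (S I) (U I) q) = ?c"
    unfolding limiter_eq using point[OF q] average
    by (simp add: linear_add linear_diff linear_scale linear_interface_map)
  \<comment> \<open>Returning from the linear condition to velocity and pressure requires the
    limited state itself to be well defined.\<close>
  then show "velocity (limiter g (cell m I) (S I) (U I) q) = u0 \<and>
      pressure g (limiter g (cell m I) (S I) (U I) q) = p0"
    using interface_map_eq_iff[OF wd_limited[OF I q]] by blast
qed

end
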